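(* Let $m,n\in\mathbb N$, $A\in M_{m,n}(\mathbb R)$, $\mathbf b\in\mathbb R^m$, and let $\tilde L_{A,\mathbf b}\mathbb Z^{m+n}=\{(A\mathbf q+\mathbf b+\mathbf p,\ \mathbf q)^T\mid \mathbf p\in\mathbb Z^m,\mathbf q\in\mathbb Z^n\}\in\Omega$. If $\tilde L_{A,\mathbf b}\mathbb Z^{m+n}\in E(F,(\Omega_0)^* )$, then the system of affine forms $\langle A,\mathbf b\rangle$ is badly approximable, i.e. $\liminf_{\mathbf p\in\mathbb Z^m,\mathbf q\in\mathbb Z^n,\mathbf q\to\infty}\|A\mathbf q+\mathbf b+\mathbf p\|^m\|\mathbf q\|^n>0$.
   Context: $\|\cdot\|$ is the max-norm. $G=SL_{m+n}(\mathbb R)\ltimes\mathbb R^{m+n}$ is the group of affine maps $\mathbf x\mapsto L\mathbf x+\mathbf w$ ($L\in SL_{m+n}(\mathbb R)$), $\Gamma=SL_{m+n}(\mathbb Z)\ltimes\mathbb Z^{m+n}$, and $\Omega=G/\Gamma$ is identified with the space of free unimodular lattices $\{\Lambda+\mathbf w\}$ ($\Lambda$ a lattice of covolume $1$ in $\mathbb R^{m+n}$, $\mathbf w\in\mathbb R^{m+n}$) with the topology in which lattices are close when their generators are close; $\Omega_0\subseteq\Omega$ is the (closed) subset of lattices containing $0$. Let $g_t=\mathrm{diag}(e^{t/m},\dots,e^{t/m},e^{-t/n},\dots,e^{-t/n})$ ($m$ entries $e^{t/m}$, $n$ entries $e^{-t/n}$) and $F=\{g_t\mid t\ge0\}$ acting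 on $\Omega$. $\tilde L_{A,\mathbf b}$ is the affine map $\mathbf x\mapsto\begin{pmatrix}I_m&A\\0&I_n\end{pmatrix}\mathbf x+(\mathbf b,0)^T$. With $\Omega^*=\Omega\cup\{\infty\}$ the one-point compactification and $(\Omega_0)^*=\Omega_0\cup\{\infty\}$, $E(F,(\Omega_0)^* )$ is the set of $y\in\Omega$ such that the closure of $Fy$ in $\Omega^*$ does not meet $(\Omega_0)^*$, i.e. $Fy$ is relatively compact in $\Omega$ and its closure contains no lattice through $0$. *)

theory Defs
  imports "HOL-Analysis.Analysis"
begin

text \<open>
  Coordinates of \<open>\<real>\<^sup>m\<^sup>+\<^sup>n\<close> are indexed by the sum type \<open>'m + 'n\<close>, where \<open>m = CARD('m)\<close> and
  \<open>n = CARD('n)\<close> are positive because HOL types are nonempty. The max-norm is the library's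
  \<open>infnorm\<close>.
\<close>

definition intvec :: "int ^ 'd \<Rightarrow> real ^ 'd" where
  "intvec z = (\<chi> i. of_int (z $ i))"

text \<open>The pair \<open>(L, w)\<close> stands for the affine map \<open>x \<mapsto> L x + w\<close>; the semidirect product carries
  the topology of \<open>SL \<times> \<real>\<^sup>d\<close>.\<close>

definition affine_app :: "(real ^ 'd ^ 'd) \<times> (real ^ 'd) \<Rightarrow> real ^ 'd \<Rightarrow> real ^ 'd" where
  "affine_app g x = fst g *v x + snd g"

definition affine_mult ::
    "(real ^ 'd ^ 'd) \<times> (real ^ 'd) \<Rightarrow> (real ^ 'd ^ 'd) \<times> (real ^ 'd) \<Rightarrow> (real ^ 'd ^ 'd) \<times> (real ^ 'd)" where
  "affine_mult g h = (fst g ** fst h, fst g *v snd h + snd g)"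

definition ASL_R :: "((real ^ 'd ^ 'd) \<times> (real ^ 'd)) set" where
  "ASL_R = {(L, w). det L = 1}"

definition ASL_Z :: "((real ^ 'd ^ 'd) \<times> (real ^ 'd)) set" where
  "ASL_Z = {(L, w). det L = 1 \<and> (\<forall>i j. L $ i $ j \<in> \<int>) \<and> (\<forall>i. w $ i \<in> \<int>)}"

definition free_lattice :: "(real ^ 'd ^ 'd) \<times> (real ^ 'd) \<Rightarrow> (real ^ 'd) set" where
  "free_lattice g = affine_app g ` range intvec"

text \<open>The underlying set of \<open>\<Omega>\<close>. By \<open>free_lattice_eq_iff\<close> below, it is in bijection with
  \<open>ASL_R / ASL_Z\<close>.\<close>

definition free_lattices :: "(real ^ 'd) set set" where
  "free_lattices = free_lattice ` ASL_R"

definition quotient_top :: "'a topology \<Rightarrow> ('a \<Rightarrow> 'b) \<Rightarrow> 'b topology" where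
  "quotient_top X f =
     topology (\<lambda>U. U \<subseteq> f ` topspace X \<and> openin X {x \<in> topspace X. f x \<in> U})"

lemma openin_quotient_top:
  "openin (quotient_top X f) U \<longleftrightarrow> U \<subseteq> f ` topspace X \<and> openin X {x \<in> topspace X. f x \<in> U}"
proof -
  have "istopology (\<lambda>U. U \<subseteq> f ` topspace X \<and> openin X {x \<in> topspace X. f x \<in> U})"
    unfolding istopology_def
  proof (intro conjI allI impI; (elim conjE)?)
    fix S T
    assume "openin X {x \<in> topspace X. f x \<in> S}" "openin X {x \<in> topspace X. f x \<in> T}"
    moreover have "{x \<in> topspace X. f x \<in> S \<inter> T} =
        {x \<in> topspace X. f x \<in> S} \<inter> {x \<in> topspace X. f x \<in> T}" by auto
    ultimately show "openin X {x \<in> topspace X. f x \<in> S \<inter> T}" by auto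
  next
    fix \<K>
    assume "\<forall>K\<in>\<K>. K \<subseteq> f ` topspace X \<and> openin X {x \<in> topspace X. f x \<in> K}"
    moreover have "{x \<in> topspace X. f x \<in> \<Union> \<K>} = (\<Union>K\<in>\<K>. {x \<in> topspace X. f x \<in> K})" by auto
    ultimately show "openin X {x \<in> topspace X. f x \<in> \<Union> \<K>}" by auto
  qed auto
  then show ?thesis
    by (simp add: quotient_top_def)
qed

lemma topspace_quotient_top [simp]: "topspace (quotient_top X f) = f ` topspace X"
proof -
  have "{x \<in> topspace X. f x \<in> f ` topspace X} = topspace X" by auto
  then have "openin (quotient_top X f) (f ` topspace X)"
    by (simp add: openin_quotient_top)
  then show ?thesis
    by (metis openin_quotient_top openin_subset openin_topspace subset_antisym)
qed

lemma quotient_map_quotient_top: "quotient_map X (quotient_top X f) f"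
  by (auto simp: quotient_map_def openin_quotient_top)

text \<open>The quotient topology along \<open>(L, w) \<mapsto> L \<int>\<^sup>d + w\<close>: lattices are close when they have close
  generators (columns of \<open>L\<close>) and translations.\<close>

definition Omega :: "(real ^ 'd) set topology" where
  "Omega = quotient_top (top_of_set ASL_R) free_lattice"

lemma topspace_Omega [simp]: "topspace Omega = free_lattices"
  by (simp add: Omega_def free_lattices_def)

definition Omega_0 :: "(real ^ 'd) set set" where
  "Omega_0 = {\<Lambda> \<in> free_lattices. 0 \<in> \<Lambda>}"

definition lattice_orbit :: "(real ^ 'd ^ 'd) set \<Rightarrow> (real ^ 'd) set \<Rightarrow> (real ^ 'd) set set" where
  "lattice_orbit H \<Lambda> = {(\<lambda>x. g *v x) ` \<Lambda> | g. g \<in> H}"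

text \<open>In \<open>Alexandroff_compactification X\<close> the point at infinity is \<open>None\<close>.\<close>

definition star_set :: "(real ^ 'd) set set \<Rightarrow> (real ^ 'd) set option set" where
  "star_set Z = insert None (Some ` Z)"

definition E_set ::
    "(real ^ 'd ^ 'd) set \<Rightarrow> (real ^ 'd) set option set \<Rightarrow> (real ^ 'd) set set" where
  "E_set H Z = {\<Lambda> \<in> free_lattices.
     (Alexandroff_compactification Omega closure_of (Some ` lattice_orbit H \<Lambda>)) \<inter> Z = {}}"

definition g_flow :: "real \<Rightarrow> real ^ ('m::finite + 'n::finite) ^ ('m + 'n)" where
  "g_flow t = (\<chi> i j. if i = j
     then (case i of Inl _ \<Rightarrow> exp (t / real CARD('m)) | Inr _ \<Rightarrow> exp (- t / real CARD('n)))
     else 0)"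

definition F_flow :: "(real ^ ('m::finite + 'n::finite) ^ ('m + 'n)) set" where
  "F_flow = g_flow ` {0..}"

definition vec_join :: "'a ^ 'm \<Rightarrow> 'a ^ 'n \<Rightarrow> 'a ^ ('m::finite + 'n::finite)" where
  "vec_join x y = (\<chi> i. case i of Inl i \<Rightarrow> x $ i | Inr j \<Rightarrow> y $ j)"

definition L_mat :: "real ^ 'n ^ 'm \<Rightarrow> real ^ ('m::finite + 'n::finite) ^ ('m + 'n)" where
  "L_mat A = (\<chi> i j. case (i, j) of
       (Inl i, Inl j) \<Rightarrow> if i = j then 1 else 0
     | (Inl i, Inr j) \<Rightarrow> A $ i $ j
     | (Inr i, Inl j) \<Rightarrow> 0
     | (Inr i, Inr j) \<Rightarrow> if i = j then 1 else 0)"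

definition L_tilde ::
    "real ^ 'n ^ 'm \<Rightarrow> real ^ 'm \<Rightarrow> (real ^ ('m::finite + 'n::finite) ^ ('m + 'n)) \<times> (real ^ ('m + 'n))" where
  "L_tilde A b = (L_mat A, vec_join b 0)"

text \<open>The filter says that \<open>q\<close> tends to infinity in \<open>\<int>\<^sup>n\<close> while \<open>p \<in> \<int>\<^sup>m\<close> is unrestricted.\<close>

definition badly_approximable_affine :: "real ^ 'n ^ 'm \<Rightarrow> real ^ 'm \<Rightarrow> bool" where
  "badly_approximable_affine A b \<longleftrightarrow>
     0 < Liminf (filtercomap (\<lambda>(p :: int ^ 'm, q :: int ^ 'n). infnorm (intvec q)) at_top)
           (\<lambda>(p, q). ereal (infnorm (A *v intvec q + b + intvec p) ^ CARD('m)
                            * infnorm (intvec q) ^ CARD('n)))"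

subsection \<open>Consistency of the definitions\<close>

lemma affine_app_mult: "affine_app (affine_mult g h) x = affine_app g (affine_app h x)"
  by (simp add: affine_app_def affine_mult_def matrix_vector_mul_assoc
      matrix_vector_right_distrib add.assoc)

lemma range_intvec: "range intvec = {x :: real ^ 'd. \<forall>i. x $ i \<in> \<int>}"
proof (intro equalityI subsetI)
  fix x :: "real ^ 'd" assume "x \<in> {x. \<forall>i. x $ i \<in> \<int>}"
  then have "x = intvec (\<chi> i. \<lfloor>x $ i\<rfloor>)"
    by (auto simp: intvec_def vec_eq_iff elim!: Ints_cases)
  then show "x \<in> range intvec" by blast
qed (auto simp: intvec_def)

lemma det_Ints:
  fixes L :: "real ^ 'd ^ 'd"
  assumes "\<And>i j. L $ i $ j \<in> \<int>"
  shows "det L \<in> \<int>"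
  unfolding det_def using assms by (intro Ints_sum Ints_mult Ints_prod) auto

lemma ASL_Z_image:
  assumes "\<gamma> \<in> ASL_Z"
  shows "affine_app \<gamma> ` range intvec = (range intvec :: (real ^ 'd) set)"
proof -
  obtain N k where g: "\<gamma> = (N, k)" "det N = 1" and N: "\<And>i j. N $ i $ j \<in> \<int>" and k: "\<And>i. k $ i \<in> \<int>"
    using assms by (auto simp: ASL_Z_def)
  show ?thesis unfolding range_intvec
  proof (intro equalityI subsetI)
    fix y assume "y \<in> affine_app \<gamma> ` {x. \<forall>i. x $ i \<in> \<int>}"
    then show "y \<in> {x. \<forall>i. x $ i \<in> \<int>}"
      using N k by (auto simp: g affine_app_def matrix_vector_mult_def intro!: Ints_add Ints_sum)
  next
    fix y :: "real ^ 'd" assume y: "y \<in> {x. \<forall>i. x $ i \<in> \<int>}"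
    define x :: "real ^ 'd" where
      "x = (\<chi> l. det (\<chi> i j. if j = l then (y - k) $ i else N $ i $ j) / det N)"
    have "N *v x = y - k"
      using cramer[of N x "y - k"] g by (simp add: x_def)
    moreover have "x $ l \<in> \<int>" for l
      using N k y g by (auto simp: x_def intro!: det_Ints)
    ultimately show "y \<in> affine_app \<gamma> ` {x. \<forall>i. x $ i \<in> \<int>}"
      by (intro image_eqI[of _ _ x]) (auto simp: g affine_app_def)
  qed
qed

lemma free_lattice_eq_iff:
  fixes g h :: "(real ^ 'd ^ 'd) \<times> (real ^ 'd)"
  assumes "g \<in> ASL_R" "h \<in> ASL_R"
  shows "free_lattice g = free_lattice h \<longleftrightarrow> (\<exists>\<gamma>\<in>ASL_Z. g = affine_mult h \<gamma>)"
proof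
  assume "\<exists>\<gamma>\<in>ASL_Z. g = affine_mult h \<gamma>"
  then obtain \<gamma> where \<gamma>: "\<gamma> \<in> ASL_Z" "g = affine_mult h \<gamma>" by blast
  then have "free_lattice g = affine_app h ` affine_app \<gamma> ` range intvec"
    by (simp add: free_lattice_def image_image affine_app_mult)
  then show "free_lattice g = free_lattice h"
    using \<gamma>(1) by (simp add: ASL_Z_image free_lattice_def)
next
  assume eq: "free_lattice g = free_lattice h"
  obtain L w where g: "g = (L, w)" "det L = 1" using assms by (auto simp: ASL_R_def)
  obtain M v where h: "h = (M, v)" "det M = 1" using assms by (auto simp: ASL_R_def)
  obtain M' where M': "M ** M' = mat 1" "M' ** M = mat 1"
    using h(2) invertible_det_nz[of M] by (auto simp: invertible_def)
  define N where "N = M' ** L"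
  define k where "k = M' *v (w - v)"
  have detN: "det N = 1"
    using arg_cong[OF M'(1), of det] g h by (simp add: N_def det_mul)
  have int: "\<forall>i. (N *v x + k) $ i \<in> \<int>" if x: "\<forall>i. x $ i \<in> \<int>" for x
  proof -
    have "L *v x + w \<in> free_lattice h"
      using x unfolding eq[symmetric] by (auto simp: free_lattice_def range_intvec g affine_app_def)
    then obtain z where z: "\<forall>i. z $ i \<in> \<int>" "L *v x + w = M *v z + v"
      by (auto simp: free_lattice_def range_intvec h affine_app_def)
    have "N *v x + k = M' *v (L *v x + w - v)"
      by (simp only: N_def k_def matrix_vector_mul_assoc[symmetric]
          matrix_vector_right_distrib[symmetric] add_diff_eq)
    also have "\<dots> = z"
      using M' by (simp add: z matrix_vector_mul_assoc)
    finally show ?thesis using z by simp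
  qed
  have k: "k $ i \<in> \<int>" for i using int[of 0] by simp
  have N: "N $ i $ j \<in> \<int>" for i j
  proof -
    have "(N *v axis j 1 + k) $ i - k $ i \<in> \<int>"
      using int[of "axis j 1"] k by (intro Ints_diff) (auto simp: axis_def)
    then show ?thesis by (simp add: matrix_vector_mult_basis column_def)
  qed
  have "M ** N = L" "M *v k = w - v"
    using M' by (simp_all add: N_def k_def matrix_mul_assoc matrix_vector_mul_assoc)
  then have "g = affine_mult h (N, k)"
    by (simp add: g h affine_mult_def)
  moreover have "(N, k) \<in> ASL_Z"
    using detN N k by (simp add: ASL_Z_def)
  ultimately show "\<exists>\<gamma>\<in>ASL_Z. g = affine_mult h \<gamma>" by blast
qed

lemma det_L_mat: "det (L_mat (A :: real ^ 'n ^ 'm)) = 1"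
proof -
  have zero: "(\<Prod>i\<in>UNIV. L_mat A $ i $ p i) = 0" if p: "p permutes UNIV" "p \<noteq> id" for p
  proof (rule ccontr)
    assume "(\<Prod>i\<in>UNIV. L_mat A $ i $ p i) \<noteq> 0"
    then have nz: "L_mat A $ i $ p i \<noteq> 0" for i by simp
    have R: "p (Inr j) = Inr j" for j
      using nz[of "Inr j"] by (auto simp: L_mat_def split: sum.splits if_splits)
    have L: "p (Inl i) = Inl i" for i
    proof (cases "p (Inl i)")
      case (Inl i')
      then show ?thesis using nz[of "Inl i"] by (auto simp: L_mat_def split: if_splits)
    next
      case (Inr j)
      then have "p (Inl i) = p (Inr j)" using R by simp
      then show ?thesis using permutes_inj[OF p(1)] by (auto dest: injD)
    qed
    have "p x = x" for x using L R by (cases x) auto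
    then show False using p(2) by (auto simp: fun_eq_iff)
  qed
  have "det (L_mat A) = (\<Sum>p\<in>{id}. of_int (sign p) * (\<Prod>i\<in>UNIV. L_mat A $ i $ p i))"
    unfolding det_def using zero
    by (intro sum.mono_neutral_right) (auto simp: finite_permutations permutes_id)
  also have "\<dots> = 1"
    by (auto simp: sign_id L_mat_def intro!: prod.neutral split: sum.splits)
  finally show ?thesis .
qed

lemma L_tilde_lattice_in_Omega: "free_lattice (L_tilde A b) \<in> free_lattices"
  by (auto simp: free_lattices_def ASL_R_def L_tilde_def det_L_mat)

lemma free_lattice_L_tilde:
  fixes A :: "real ^ 'n ^ 'm"
  shows "free_lattice (L_tilde A b) =
    {vec_join (A *v intvec q + b + intvec p) (intvec q) | p q. True}"
proof -
  have sumsplit: "(\<Sum>j\<in>UNIV. f j) = (\<Sum>j\<in>UNIV. f (Inl j)) + (\<Sum>j\<in>UNIV. f (Inr j))"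
    for f :: "'m + 'n \<Rightarrow> real"
    unfolding UNIV_Plus_UNIV[symmetric] by (subst sum.Plus) auto
  have *: "affine_app (L_tilde A b) (vec_join x y) = vec_join (A *v y + b + x) y" for x y
  proof -
    have "affine_app (L_tilde A b) (vec_join x y) $ i = vec_join (A *v y + b + x) y $ i" for i
      by (cases i) (auto simp: affine_app_def L_tilde_def matrix_vector_mult_def
          sumsplit L_mat_def vec_join_def if_distrib[of "\<lambda>x. x * _"] cong: if_cong)
    then show ?thesis by (simp add: vec_eq_iff)
  qed
  have join: "intvec (vec_join p q) = vec_join (intvec p) (intvec q)" for p :: "int ^ 'm" and q :: "int ^ 'n"
    by (auto simp: intvec_def vec_join_def vec_eq_iff split: sum.splits)
  have "\<exists>p q. z = vec_join p q" for z :: "int ^ ('m + 'n)"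
    by (rule exI[of _ "\<chi> i. z $ Inl i"], rule exI[of _ "\<chi> i. z $ Inr i"])
       (auto simp: vec_join_def vec_eq_iff split: sum.splits)
  then have "range intvec = {vec_join (intvec p) (intvec q) | (p :: int ^ 'm) (q :: int ^ 'n). True}"
    by (auto simp: join[symmetric]) (metis rangeI)
  then show ?thesis
    unfolding free_lattice_def by (auto simp: *[symmetric])
qed

end

theory Submission
  imports Defs
begin

text \<open>
  The Alexandroff compactification is compact, so the closure of the orbit, which avoids
  \<open>\<infinity>\<close> and the lattices through \<open>0\<close>, is covered by finitely many of the increasing open sets
  of lattices avoiding the ball of radius \<open>\<delta>\<close> around \<open>0\<close>. Hence one \<open>\<delta>\<close> works for the whole
  orbit. If \<open>\<parallel>A q + b + p\<parallel>\<^sup>m \<parallel>q\<parallel>\<^sup>n\<close> were small for some large \<open>q\<close>, the flow at the time \<open>t\<close> with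
  \<open>exp (- t / n) \<parallel>q\<parallel> = \<delta>\<close> would bring the corresponding point of the lattice into that ball.
\<close>

lemma continuous_on_det [continuous_intros]:
  fixes f :: "'a::topological_space \<Rightarrow> real ^ 'd ^ 'd"
  assumes "\<And>i j. continuous_on S (\<lambda>x. f x $ i $ j)"
  shows "continuous_on S (\<lambda>x. det (f x))"
  unfolding det_def by (intro continuous_intros assms)

lemma closed_range_intvec: "closed (range intvec :: (real ^ 'd) set)"
proof -
  have "closed {x :: real ^ 'd. x $ i \<in> \<int>}" for i
    using continuous_closed_vimage[OF closed_Ints, of "\<lambda>x :: real ^ 'd. x $ i"]
    by (simp add: vimage_def)
  then show ?thesis
    by (simp add: range_intvec closed_Collect_all)
qed

text \<open>Cramer's rule for \<open>L x + w = y\<close> without the denominator \<open>det L\<close>, so that it is continuous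
  on all pairs \<open>(L, w)\<close>; it solves the equation when \<open>det L = 1\<close>.\<close>

definition affine_cramer :: "(real ^ 'd) \<times> (real ^ 'd ^ 'd) \<times> (real ^ 'd) \<Rightarrow> real ^ 'd" where
  "affine_cramer = (\<lambda>(y, L, w). \<chi> k. det (\<chi> i j. if j = k then (y - w) $ i else L $ i $ j))"

lemma continuous_on_affine_cramer:
  fixes S :: "((real ^ 'd) \<times> (real ^ 'd ^ 'd) \<times> (real ^ 'd)) set"
  shows "continuous_on S affine_cramer"
proof -
  have "continuous_on S (\<lambda>p. if j = k then (fst p - snd (snd p)) $ i else fst (snd p) $ i $ j)"
    for i j k by (cases "j = k") (auto intro!: continuous_intros)
  then show ?thesis
    unfolding affine_cramer_def case_prod_beta by (intro continuous_intros) simp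
qed

text \<open>Cramer's rule makes \<open>affine_cramer (y, g)\<close> the unique preimage of
  \<open>y\<close> under the affine map \<open>g\<close>, so membership becomes integrality of a
  function continuous in \<open>y\<close> and \<open>g\<close> jointly.\<close>

lemma mem_free_lattice_iff:
  assumes "g \<in> ASL_R"
  shows "y \<in> free_lattice g \<longleftrightarrow> affine_cramer (y, g) \<in> range intvec"
proof -
  obtain L w where g: "g = (L, w)" "det L = 1" using assms by (auto simp: ASL_R_def)
  have "y = affine_app g x \<longleftrightarrow> x = affine_cramer (y, g)" for x
    using cramer[of L x "y - w"] g by (auto simp: affine_app_def affine_cramer_def algebra_simps)
  then show ?thesis by (simp add: free_lattice_def image_iff)
qed

text \<open>The ball is closed, hence compact, which is what makes avoiding it an open condition on
  the lattice.\<close>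

definition lattices_avoiding :: "real \<Rightarrow> (real ^ 'd) set set" where
  "lattices_avoiding \<delta> = {\<Lambda> \<in> free_lattices. \<Lambda> \<inter> cball 0 \<delta> = {}}"

text \<open>Openness in the quotient is openness of the preimage in \<open>ASL_R\<close>. There the
  generators whose lattice meets the ball are cut out by a projection of the closed set
  \<open>T\<close>.\<close>

lemma openin_lattices_avoiding: "openin Omega (lattices_avoiding \<delta> :: (real ^ 'd) set set)"
proof -
  define T :: "((real ^ 'd) \<times> (real ^ 'd ^ 'd) \<times> (real ^ 'd)) set"
    where "T = affine_cramer -` range intvec"
  have "closed T"
    unfolding T_def by (intro closed_vimage closed_range_intvec continuous_on_affine_cramer)
  then have "closedin (top_of_set (cball 0 \<delta> \<times> UNIV)) ((cball 0 \<delta> \<times> UNIV) \<inter> T)"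
    by (simp add: closedin_closed_Int)
  \<comment> \<open>Projection along the compact factor \<open>cball 0 \<delta>\<close> maps closed
    sets to closed sets.\<close>
  from closedin_compact_projection[OF compact_cball this]
  have "open (- {g. \<exists>y. y \<in> cball 0 \<delta> \<and> (y, g) \<in> T})" by (simp add: open_Compl)
  moreover have "{g \<in> ASL_R. free_lattice g \<in> lattices_avoiding \<delta>} =
      ASL_R \<inter> - {g. \<exists>y. y \<in> cball 0 \<delta> \<and> (y, g) \<in> T}"
    by (auto simp: lattices_avoiding_def free_lattices_def T_def mem_free_lattice_iff disjoint_iff)
  ultimately show ?thesis
    by (auto simp: Omega_def openin_quotient_top lattices_avoiding_def free_lattices_def
        intro!: openin_open_Int)
qed

lemma lattices_avoiding_mono: "\<delta> \<le> \<delta>' \<Longrightarrow> lattices_avoiding \<delta>' \<subseteq> lattices_avoiding \<delta>"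
  by (auto simp: lattices_avoiding_def disjoint_iff)

text \<open>For fixed \<open>g\<close> the lattice is the preimage of the closed set of integer
  vectors under a continuous map, so its complement is open.\<close>

lemma lattice_avoids_ball:
  fixes \<Lambda> :: "(real ^ 'd) set"
  assumes "\<Lambda> \<in> free_lattices" "0 \<notin> \<Lambda>"
  obtains \<delta> where "0 < \<delta>" "\<Lambda> \<in> lattices_avoiding \<delta>"
proof -
  obtain g where g: "g \<in> ASL_R" "\<Lambda> = free_lattice g" using assms by (auto simp: free_lattices_def)
  have "\<Lambda> = (\<lambda>y. affine_cramer (y, g)) -` range intvec"
    using g by (auto simp: mem_free_lattice_iff)
  moreover have "continuous_on UNIV (\<lambda>y. affine_cramer (y, g))"
    by (rule continuous_on_compose2[OF continuous_on_affine_cramer[of UNIV]])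
       (auto intro: continuous_intros)
  ultimately have "closed \<Lambda>" by (simp add: closed_range_intvec closed_vimage)
  then obtain \<delta> where "0 < \<delta>" "cball 0 \<delta> \<subseteq> - \<Lambda>"
    using assms(2) open_contains_cball[of "- \<Lambda>"] by (auto simp: open_Compl)
  then show ?thesis
    using that assms(1) by (fastforce simp: lattices_avoiding_def)
qed

text \<open>This places the orbit in the underlying space of \<open>Omega\<close>, so that it is
  contained in its own closure.\<close>

lemma lattice_orbit_subset:
  assumes "\<Lambda> \<in> free_lattices" "\<And>g. g \<in> H \<Longrightarrow> det g = 1"
  shows "lattice_orbit H \<Lambda> \<subseteq> free_lattices"
proof -
  obtain L w where L: "det L = 1" "\<Lambda> = free_lattice (L, w)"
    using assms(1) by (auto simp: free_lattices_def ASL_R_def)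
  have "(\<lambda>x. g *v x) ` \<Lambda> = free_lattice (g ** L, g *v w)" for g
    by (simp add: L free_lattice_def image_image affine_app_def matrix_vector_right_distrib
        matrix_vector_mul_assoc)
  then show ?thesis
    using L(1) assms(2) by (auto simp: lattice_orbit_def free_lattices_def ASL_R_def det_mul)
qed

lemma E_set_orbit_avoids_ball:
  assumes "\<Lambda> \<in> E_set H (star_set Omega_0)" "\<And>g. g \<in> H \<Longrightarrow> det g = 1"
  obtains \<delta> where "0 < \<delta>" "lattice_orbit H \<Lambda> \<subseteq> lattices_avoiding \<delta>"
proof -
  define X where "X = Alexandroff_compactification (Omega :: (real ^ 'a) set topology)"
  define D where "D = X closure_of (Some ` lattice_orbit H \<Lambda>)"
  define \<U> where "\<U> = (\<lambda>\<delta>. Some ` lattices_avoiding \<delta> :: (real ^ 'a) set option set) ` {0<..}"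
  have disj: "D \<inter> star_set Omega_0 = {}" and \<Lambda>: "\<Lambda> \<in> free_lattices"
    using assms(1) by (auto simp: E_set_def D_def X_def)
  have "compactin X D"
    by (simp add: D_def X_def closedin_compact_space)
  moreover have "openin X U" if "U \<in> \<U>" for U
    using that by (auto simp: \<U>_def X_def openin_lattices_avoiding)
  moreover have "D \<subseteq> \<Union>\<U>"
  proof
    fix x assume x: "x \<in> D"
    have "D \<subseteq> topspace X" by (simp add: D_def closure_of_subset_topspace)
    then have "x \<in> insert None (Some ` free_lattices)" using x by (auto simp: X_def)
    \<comment> \<open>Disjointness from \<open>star_set Omega_0\<close> rules out both
      \<open>None\<close> and the lattices through 0.\<close>
    then obtain M where M: "x = Some M" "M \<in> free_lattices" "0 \<notin> M"
      using disj x by (auto simp: star_set_def Omega_0_def)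
    then obtain \<delta> where "0 < \<delta>" "M \<in> lattices_avoiding \<delta>"
      using lattice_avoids_ball by blast
    then show "x \<in> \<Union>\<U>"
      using M(1) by (auto simp: \<U>_def)
  qed
  ultimately obtain \<F> where \<F>: "finite \<F>" "\<F> \<subseteq> \<U>" "D \<subseteq> \<Union>\<F>"
    using compactinD[of X D \<U>] by blast
  then obtain R where R: "finite R" "R \<subseteq> {0<..}"
    "\<F> = (\<lambda>\<delta>. Some ` lattices_avoiding \<delta>) ` R"
    unfolding \<U>_def by (meson finite_subset_image)
  \<comment> \<open>The sets grow as the radius shrinks, so the smallest radius serves for the whole
    subcover; the 1 keeps \<open>Min\<close> meaningful when \<open>R\<close> is empty.\<close>
  define \<delta> where "\<delta> = Min (insert 1 R)"
  have "0 < \<delta>" "\<And>r. r \<in> R \<Longrightarrow> \<delta> \<le> r"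
    using R by (auto simp: \<delta>_def)
  then have "\<Union>\<F> \<subseteq> Some ` lattices_avoiding \<delta>"
    using lattices_avoiding_mono by (fastforce simp: R(3))
  moreover have "Some ` lattice_orbit H \<Lambda> \<subseteq> D"
    unfolding D_def using lattice_orbit_subset[OF \<Lambda> assms(2)]
    by (intro closure_of_subset) (auto simp: X_def)
  ultimately have "Some ` lattice_orbit H \<Lambda> \<subseteq> Some ` lattices_avoiding \<delta>"
    using \<F>(3) by (meson order_trans)
  then have "lattice_orbit H \<Lambda> \<subseteq> lattices_avoiding \<delta>"
    by (simp add: inj_image_subset_iff)
  then show ?thesis using that \<open>0 < \<delta>\<close> by blast
qed

lemma prod_UNIV_sum:
  "(\<Prod>i\<in>UNIV. f i) = (\<Prod>i\<in>UNIV. f (Inl i)) * (\<Prod>j\<in>UNIV. f (Inr j))"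
  for f :: "'m::finite + 'n::finite \<Rightarrow> 'a::comm_monoid_mult"
  unfolding UNIV_Plus_UNIV[symmetric] by (subst prod.Plus) auto

lemma det_g_flow: "det (g_flow t :: real ^ ('m::finite + 'n::finite) ^ ('m + 'n)) = 1"
proof -
  have "det (g_flow t :: real ^ ('m + 'n) ^ ('m + 'n)) =
      (\<Prod>i\<in>UNIV. (g_flow t :: real ^ ('m + 'n) ^ ('m + 'n)) $ i $ i)"
    by (rule det_diagonal) (simp add: g_flow_def)
  also have "\<dots> = exp (t / real CARD('m)) ^ CARD('m) * exp (- t / real CARD('n)) ^ CARD('n)"
    by (simp add: prod_UNIV_sum g_flow_def)
  also have "\<dots> = 1"
    by (simp flip: exp_of_nat_mult exp_add)
  finally show ?thesis .
qed

lemma g_flow_mult_vec: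
  "(g_flow t *v v) $ i =
     (case i of Inl _ \<Rightarrow> exp (t / real CARD('m)) | Inr _ \<Rightarrow> exp (- t / real CARD('n))) * v $ i"
  for v :: "real ^ ('m::finite + 'n::finite)"
  by (simp add: g_flow_def matrix_vector_mult_def if_distrib[of "\<lambda>x. x * _"] cong: if_cong)

lemma infnorm_le_cart:
  fixes x :: "real ^ 'd"
  assumes "\<And>i. \<bar>x $ i\<bar> \<le> B"
  shows "infnorm x \<le> B"
  unfolding infnorm_cart using assms by (intro cSup_least) auto

text \<open>Each block is scaled by a single factor, and the max-norm lets the two be bounded
  separately.\<close>

lemma infnorm_g_flow_le:
  fixes x :: "real ^ 'm::finite" and y :: "real ^ 'n::finite"
  assumes "exp (t / real CARD('m)) * infnorm x \<le> B" "exp (- t / real CARD('n)) * infnorm y \<le> B"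
  shows "infnorm (g_flow t *v vec_join x y) \<le> B"
proof (rule infnorm_le_cart)
  fix i :: "'m + 'n"
  have "exp (t / real CARD('m)) * \<bar>x $ k\<bar> \<le> B" for k
    using assms(1) component_le_infnorm_cart[of x k] mult_left_mono[of _ _ "exp (t / real CARD('m))"]
    by (meson exp_ge_zero order_trans)
  moreover have "exp (- t / real CARD('n)) * \<bar>y $ k\<bar> \<le> B" for k
    using assms(2) component_le_infnorm_cart[of y k] mult_left_mono[of _ _ "exp (- t / real CARD('n))"]
    by (meson exp_ge_zero order_trans)
  ultimately show "\<bar>(g_flow t *v vec_join x y) $ i\<bar> \<le> B"
    by (cases i) (auto simp: g_flow_mult_vec vec_join_def abs_mult)
qed

theorem theorem1p7:
  fixes A :: "real ^ 'n ^ 'm" and b :: "real ^ 'm"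
  assumes "free_lattice (L_tilde A b) \<in> E_set F_flow (star_set Omega_0)"
  shows "badly_approximable_affine A b"
proof -
  let ?\<Lambda> = "free_lattice (L_tilde A b)" and ?m = "CARD('m)" and ?n = "CARD('n)"
  obtain r where r: "0 < r" "lattice_orbit F_flow ?\<Lambda> \<subseteq> lattices_avoiding r"
    by (rule E_set_orbit_avoids_ball[OF assms]) (auto simp: F_flow_def det_g_flow)
  \<comment> \<open>The avoided ball is Euclidean; the Euclidean norm is at most \<open>c\<close>
    times the max-norm, so \<open>r / c\<close> is a radius for the max-norm.\<close>
  define c where "c = sqrt DIM(real ^ ('m + 'n))"
  define \<delta> where "\<delta> = r / c"
  have c: "0 < c" unfolding c_def by (metis DIM_positive of_nat_0_less_iff real_sqrt_gt_zero)
  then have \<delta>: "0 < \<delta>" using r(1) by (simp add: \<delta>_def)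
  have far: "\<delta> < infnorm (g_flow t *v vec_join (A *v intvec q + b + intvec p) (intvec q))"
    if "0 \<le> t" for t and p :: "int ^ 'm" and q :: "int ^ 'n"
  proof -
    let ?v = "g_flow t *v vec_join (A *v intvec q + b + intvec p) (intvec q)"
    have "(\<lambda>x. g_flow t *v x) ` ?\<Lambda> \<in> lattices_avoiding r"
      using r(2) that by (auto simp: lattice_orbit_def F_flow_def)
    moreover have "?v \<in> (\<lambda>x. g_flow t *v x) ` ?\<Lambda>"
      by (auto simp: free_lattice_L_tilde)
    ultimately have "?v \<notin> cball 0 r" by (auto simp: lattices_avoiding_def)
    then have "r < c * infnorm ?v"
      using norm_le_infnorm[of ?v, folded c_def] by simp
    then show ?thesis using c by (simp add: \<delta>_def divide_less_eq mult.commute)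
  qed
  have bound: "\<delta> ^ (?m + ?n) \<le> infnorm (A *v intvec q + b + intvec p) ^ ?m * infnorm (intvec q) ^ ?n"
    if q: "\<delta> \<le> infnorm (intvec q)" for p :: "int ^ 'm" and q :: "int ^ 'n"
  proof (rule ccontr)
    define x where "x = infnorm (A *v intvec q + b + intvec p)"
    define R where "R = infnorm (intvec q)"
    \<comment> \<open>The condition \<open>\<delta> \<le> R\<close> makes the logarithm nonnegative,
      so that \<open>g_flow t\<close> belongs to \<open>F_flow\<close>.\<close>
    define t where "t = real ?n * ln (R / \<delta>)"
    assume "\<not> ?thesis"
    then have small: "x ^ ?m * R ^ ?n < \<delta> ^ (?m + ?n)" by (simp add: x_def R_def)
    have R: "\<delta> \<le> R" "0 < R" using q \<delta> by (auto simp: R_def)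
    have t: "0 \<le> t" using R \<delta> by (simp add: t_def)
    have "exp (- t / real ?n) = \<delta> / R"
      using R \<delta> by (simp add: t_def exp_minus)
    then have *: "exp (- t / real ?n) * R \<le> \<delta>" using R by simp
    have "exp t = (R / \<delta>) ^ ?n"
      using R \<delta> by (simp add: t_def exp_of_nat_mult)
    \<comment> \<open>Taking \<open>m\<close>-th powers turns \<open>exp (t / m)\<close> into
      \<open>exp t\<close>, a power of \<open>R / \<delta>\<close>, so that \<open>small\<close>
      applies.\<close>
    then have "(exp (t / real ?m) * x) ^ ?m = (R / \<delta>) ^ ?n * x ^ ?m"
      by (simp add: power_mult_distrib flip: exp_of_nat_mult)
    also have "\<dots> < \<delta> ^ ?m"
      using small \<delta> by (simp add: power_divide divide_less_eq power_add mult.commute)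
    finally have "exp (t / real ?m) * x \<le> \<delta>"
      using \<delta> by (meson less_imp_le power_less_imp_less_base)
    with * infnorm_g_flow_le far[OF t, of q p] show False
      unfolding x_def R_def by (meson not_le)
  qed
  \<comment> \<open>The threshold on \<open>q\<close> in \<open>bound\<close> is uniform in
    \<open>p\<close>, so the bound holds eventually along the filter.\<close>
  have "ereal (\<delta> ^ (?m + ?n)) \<le>
      Liminf (filtercomap (\<lambda>(p :: int ^ 'm, q :: int ^ 'n). infnorm (intvec q)) at_top)
        (\<lambda>(p, q). ereal (infnorm (A *v intvec q + b + intvec p) ^ ?m * infnorm (intvec q) ^ ?n))"
    using bound
    by (intro Liminf_bounded) (auto simp: eventually_filtercomap_at_top_linorder)
  moreover have "0 < ereal (\<delta> ^ (?m + ?n))" using \<delta> by simp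
  ultimately show ?thesis
    unfolding badly_approximable_affine_def by (rule less_le_trans[rotated])
qed

end
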